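(* Let $(Q,\cdot,\backslash,/)$ be a left division right cancelation groupoid which satisfies the Tarki associative law $x\cdot(z\cdot y)=(x\cdot y)\cdot z$ for all $x,y,z\in Q$. Then $(Q,\cdot)$ is a commutative group, and it satisfies each of the following identities for all $x,y,z\in Q$: $x\cdot(y\cdot z)=(x\cdot y)\cdot z$; $x\cdot(y\cdot z)=z\cdot(y\cdot x)$; $x\cdot(y\cdot z)=y\cdot(x\cdot z)$; $x\cdot(y\cdot z)=(z\cdot x)\cdot y$.
   Context: A groupoid $(Q,\cdot)$ is a non-empty set $Q$ with a binary operation $\cdot$. For $a\in Q$ let $L_a,R_a:Q\to Q$, $L_a x=a\cdot x$, $R_a x=x\cdot a$. The groupoid is a left division groupoid if $L_a$ is surjective for every $a\in Q$, and a right cancelation groupoid if $R_a$ is injective for every $a\in Q$. Writing a left division right cancelation groupoid as $(Q,\cdot,\backslash,/)$ means that $\backslash$ and $/$ are binary operations on $Q$ satisfying $x\cdot(x\backslash y)=y$ and $(y\cdot x)/x=y$ for all $x,y\in Q$. *)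

theory Defs
  imports "HOL-Algebra.Group"
begin

text \<open>
  A groupoid is here a magma on a non-empty carrier set, with no identity element given.
  The operations are functions on the ambient type that are constrained only on the carrier.
\<close>

locale groupoid =
  fixes Q :: "'a set"
    and mul :: "'a \<Rightarrow> 'a \<Rightarrow> 'a" (infixl \<open>\<cdot>\<close> 70)
  assumes nonempty: "Q \<noteq> {}"
    and mul_closed: "\<lbrakk>x \<in> Q; y \<in> Q\<rbrakk> \<Longrightarrow> x \<cdot> y \<in> Q"

locale left_division_groupoid = groupoid +
  assumes left_translation_surj: "a \<in> Q \<Longrightarrow> (\<lambda>x. a \<cdot> x) ` Q = Q"

locale right_cancelation_groupoid = groupoid +
  assumes right_translation_inj: "a \<in> Q \<Longrightarrow> inj_on (\<lambda>x. x \<cdot> a) Q"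

text \<open>
  In the next locale \<open>ldiv x y\<close> stands for $x \backslash y$ and \<open>rdiv y x\<close> for $y / x$.
  The operation \<open>ldiv\<close> chooses preimages under left translations, and \<open>rdiv\<close> extends the
  inverses of right translations to all of \<open>Q\<close>.
\<close>

locale left_division_right_cancelation_groupoid =
  left_division_groupoid Q mul + right_cancelation_groupoid Q mul
  for Q :: "'a set"
    and mul :: "'a \<Rightarrow> 'a \<Rightarrow> 'a" (infixl \<open>\<cdot>\<close> 70) +
  fixes ldiv :: "'a \<Rightarrow> 'a \<Rightarrow> 'a"
    and rdiv :: "'a \<Rightarrow> 'a \<Rightarrow> 'a"
  assumes ldiv_closed: "\<lbrakk>x \<in> Q; y \<in> Q\<rbrakk> \<Longrightarrow> ldiv x y \<in> Q"
    and rdiv_closed: "\<lbrakk>x \<in> Q; y \<in> Q\<rbrakk> \<Longrightarrow> rdiv x y \<in> Q"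
    and mul_ldiv: "\<lbrakk>x \<in> Q; y \<in> Q\<rbrakk> \<Longrightarrow> x \<cdot> ldiv x y = y"
    and rdiv_mul: "\<lbrakk>x \<in> Q; y \<in> Q\<rbrakk> \<Longrightarrow> rdiv (y \<cdot> x) x = y"

end

theory Submission
  imports Defs
begin

text \<open>
  If \<open>a \<cdot> e = a\<close> for one \<open>a\<close>, then \<open>(w \<cdot> e) \<cdot> a = w \<cdot> (a \<cdot> e) = w \<cdot> a\<close>, and cancelling \<open>a\<close>
  shows that \<open>e\<close> is a right identity. It is also a left identity, because every element has the
  form \<open>e \<cdot> s\<close> and \<open>e \<cdot> (e \<cdot> s) = (e \<cdot> s) \<cdot> e = e \<cdot> s\<close>. Once there is an identity, the Tarki law
  at \<open>x = e\<close> is commutativity.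
\<close>

theorem theorem7:
  fixes Q :: "'a set"
    and mul :: "'a \<Rightarrow> 'a \<Rightarrow> 'a" (infixl \<open>\<cdot>\<close> 70)
    and ldiv rdiv :: "'a \<Rightarrow> 'a \<Rightarrow> 'a"
  assumes "left_division_right_cancelation_groupoid Q (\<cdot>) ldiv rdiv"
    and "\<forall>x\<in>Q. \<forall>y\<in>Q. \<forall>z\<in>Q. x \<cdot> (z \<cdot> y) = (x \<cdot> y) \<cdot> z"
  shows "(\<exists>e\<in>Q. comm_group \<lparr>carrier = Q, mult = (\<cdot>), one = e\<rparr>)
    \<and> (\<forall>x\<in>Q. \<forall>y\<in>Q. \<forall>z\<in>Q. x \<cdot> (y \<cdot> z) = (x \<cdot> y) \<cdot> z)
    \<and> (\<forall>x\<in>Q. \<forall>y\<in>Q. \<forall>z\<in>Q. x \<cdot> (y \<cdot> z) = z \<cdot> (y \<cdot> x))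
    \<and> (\<forall>x\<in>Q. \<forall>y\<in>Q. \<forall>z\<in>Q. x \<cdot> (y \<cdot> z) = y \<cdot> (x \<cdot> z))
    \<and> (\<forall>x\<in>Q. \<forall>y\<in>Q. \<forall>z\<in>Q. x \<cdot> (y \<cdot> z) = (z \<cdot> x) \<cdot> y)"
proof -
  interpret left_division_right_cancelation_groupoid Q "(\<cdot>)" ldiv rdiv
    by (fact assms(1))
  have tarki: "x \<cdot> (z \<cdot> y) = (x \<cdot> y) \<cdot> z" if "x \<in> Q" "y \<in> Q" "z \<in> Q" for x y z
    using assms(2) that by blast
  have rcancel: "x = y" if "x \<cdot> a = y \<cdot> a" "x \<in> Q" "y \<in> Q" "a \<in> Q" for x y a
    using right_translation_inj[OF \<open>a \<in> Q\<close>] that by (auto dest: inj_onD)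
  obtain a where a: "a \<in> Q"
    using nonempty by blast
  define e where "e = ldiv a a"
  have e: "e \<in> Q" and ae: "a \<cdot> e = a"
    using a by (simp_all add: e_def ldiv_closed mul_ldiv)
  have right_id: "w \<cdot> e = w" if w: "w \<in> Q" for w
  proof (rule rcancel[of _ a])
    show "(w \<cdot> e) \<cdot> a = w \<cdot> a"
      using tarki[of w e a] w a e ae by simp
  qed (use w a e mul_closed in auto)
  have left_id: "e \<cdot> u = u" if u: "u \<in> Q" for u
  proof -
    define s where "s = ldiv e u"
    have s: "s \<in> Q" and es: "e \<cdot> s = u"
      using e u by (simp_all add: s_def ldiv_closed mul_ldiv)
    have "e \<cdot> (e \<cdot> s) = e \<cdot> s"
      using tarki[of e s e] right_id e s mul_closed by simp
    then show ?thesis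
      by (simp add: es)
  qed
  have comm: "x \<cdot> y = y \<cdot> x" if "x \<in> Q" "y \<in> Q" for x y
    using tarki[of e y x] left_id e that mul_closed by simp
  have assoc: "x \<cdot> (y \<cdot> z) = (x \<cdot> y) \<cdot> z" if "x \<in> Q" "y \<in> Q" "z \<in> Q" for x y z
    \<comment> \<open>The Tarki law differs from associativity only by the order of the inner
      factors, which \<open>comm\<close> swaps.\<close>
    using tarki[of x y z] comm[of y z] that by simp
  have "comm_group \<lparr>carrier = Q, mult = (\<cdot>), one = e\<rparr>"
  proof (rule comm_groupI)
    fix x assume "x \<in> carrier \<lparr>carrier = Q, mult = (\<cdot>), one = e\<rparr>"
    \<comment> \<open>\<open>ldiv x e\<close> is a right inverse of \<open>x\<close> by
      \<open>mul_ldiv\<close>; \<open>comm\<close> makes it the left inverse that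
      \<open>comm_groupI\<close> asks for.\<close>
    then have "ldiv x e \<in> Q" "ldiv x e \<cdot> x = e"
      using e comm[of "ldiv x e" x] by (simp_all add: ldiv_closed mul_ldiv)
    then show "\<exists>y\<in>carrier \<lparr>carrier = Q, mult = (\<cdot>), one = e\<rparr>.
        y \<otimes>\<^bsub>\<lparr>carrier = Q, mult = (\<cdot>), one = e\<rparr>\<^esub> x = \<one>\<^bsub>\<lparr>carrier = Q, mult = (\<cdot>), one = e\<rparr>\<^esub>"
      by auto
  qed (use e in \<open>auto simp: mul_closed assoc left_id intro: comm\<close>)
  moreover have "x \<cdot> (y \<cdot> z) = z \<cdot> (y \<cdot> x)" if "x \<in> Q" "y \<in> Q" "z \<in> Q" for x y z
    \<comment> \<open>Both sides equal \<open>(y \<cdot> z) \<cdot> x\<close>.\<close>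
    using that comm[of x "y \<cdot> z"] comm[of y z] assoc[of z y x] mul_closed[of y z] by simp
  moreover have "x \<cdot> (y \<cdot> z) = y \<cdot> (x \<cdot> z)" if "x \<in> Q" "y \<in> Q" "z \<in> Q" for x y z
    using that comm[of x y] assoc[of x y z] assoc[of y x z] by simp
  moreover have "x \<cdot> (y \<cdot> z) = (z \<cdot> x) \<cdot> y" if "x \<in> Q" "y \<in> Q" "z \<in> Q" for x y z
    \<comment> \<open>The Tarki law with \<open>y\<close> and \<open>z\<close> exchanged gives
      \<open>(x \<cdot> z) \<cdot> y\<close>, and \<open>comm\<close> reverses the inner
      product.\<close>
    using that comm[of x z] tarki[of x z y] by simp
  ultimately show ?thesis
    using e assoc by (intro conjI bexI[of _ e] ballI)
qed

end
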